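(* Each of the following eight conditional linear information inequalities (the first three and the last two concerning quadruples $(A,B,C,D)$, the others concerning quintuples $(A,B,C,D,E)$ of jointly distributed random variables) is essentially conditional: ($\mathcal I1$) if $I(A:B|C)=I(A:B)=0$, then $\square_{AB,CD}\ge 0$; ($\mathcal I2$) if $I(A:B|C)=I(B:D|C)=0$, then $\square_{AB,CD}\ge 0$; ($\mathcal I3$) if $I(A:B|C)=H(C|A,B)=0$, then $\square_{AB,CD}\ge 0$; ($\mathcal I4$) if $I(A:D|C)=I(A:C|D)=0$, then $\square_{AB,CD}+I(A:C|E)+I(A:E|C)\ge 0$; ($\mathcal I5$) if $I(B:C|D)=I(C:D|B)=0$, then $\square_{AB,CD}+I(B:C|E)+I(C:E|B)\ge 0$; ($\mathcal I6$) if $I(B:C|D)=I(C:D|B)=0$, then $\square_{AB,CD}+I(C:D|E)+I(C:E|D)\ge 0$; ($\mathcal I4'$) if $I(A:D|C)=I(A:C|D)=0$, then $\square_{AB,CD}\ge 0$; ($\mathcal I5'$) if $I(B:C|D)=I(C:D|B)=0$, then $\square_{AB,CD}\ge 0$. That is, for each of these eight implications, writing it as $(\beta_1=0 \text{ and } \beta_2=0)\Rightarrow \alpha\ge 0$, for all real numbers $\lambda_1,\lambda_2$ there exists a joint distribution of the random variables involved for which $$\alpha+\lambda_1\beta_1+\lambda_2\beta_2<0 .$$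
   Context: All random variables are discrete with finite range; $H$ denotes Shannon entropy, $H(X|Y)=H(X,Y)-H(Y)$, $I(X:Y)=H(X)+H(Y)-H(X,Y)$ and $I(X:Y|Z)=H(X,Z)+H(Y,Z)-H(X,Y,Z)-H(Z)$. Notation: $\square_{AB,CD}:=I(C:D|A)+I(C:D|B)+I(A:B)-I(C:D)$. A conditional linear information inequality is an implication $(\beta_i(\mathcal X)=0 \text{ for all } i=1,\dots,m)\Rightarrow \alpha(\mathcal X)\ge 0$ that holds for all distributions of $\mathcal X=(X_1,\dots,X_n)$, where $\alpha,\beta_1,\dots,\beta_m$ are linear combinations (with real coefficients) of the entropies $H(X)$ of non-empty subtuples $X$ of $\mathcal X$. It is called essentially conditional if for all real $(\lambda_i)_{1\le i\le m}$ the inequality $\alpha(\mathcal X)+\sum_{i=1}^m\lambda_i\beta_i(\mathcal X)\ge 0$ fails for at least one distribution $\mathcal X$. The eight listed implications are known to hold for all distributions. *)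

theory Defs
  imports "HOL-Probability.Probability"
begin

(* Tuples of jointly distributed random variables are families X indexed by a finite type 'i.
   Finite range is expressed by simple_function. Since only the joint distribution matters and it
   has finite support, sample space and values are taken in the natural numbers without loss. *)

definition random_tuple :: "nat measure \<Rightarrow> ('i::finite \<Rightarrow> nat \<Rightarrow> nat) \<Rightarrow> bool" where
  "random_tuple M X \<longleftrightarrow> prob_space M \<and> (\<forall>i. simple_function M (X i))"

definition subtuple :: "('i \<Rightarrow> nat \<Rightarrow> nat) \<Rightarrow> 'i set \<Rightarrow> nat \<Rightarrow> ('i \<Rightarrow> nat)" where
  "subtuple X S = (\<lambda>\<omega>. restrict (\<lambda>i. X i \<omega>) S)"

(* Entropy in bits; replacing base 2 by another base only rescales all entropies by a common
   positive factor. *)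
definition tuple_entropy :: "nat measure \<Rightarrow> ('i::finite \<Rightarrow> nat \<Rightarrow> nat) \<Rightarrow> 'i set \<Rightarrow> real" where
  "tuple_entropy M X S =
     prob_space.entropy M 2 (count_space (subtuple X S ` space M)) (subtuple X S)"

(* A linear combination of the entropies of subtuples is given by its coefficients, one for each
   set of indices. The coefficient of the empty set is ignored by info_value. *)
type_synonym 'i info_expr = "real ^ ('i set)"

definition info_value :: "nat measure \<Rightarrow> ('i::finite \<Rightarrow> nat \<Rightarrow> nat) \<Rightarrow> 'i info_expr \<Rightarrow> real" where
  "info_value M X c = (\<Sum>S | S \<noteq> {}. c $ S * tuple_entropy M X S)"

definition ent :: "'i set \<Rightarrow> 'i::finite info_expr" where
  "ent S = axis S 1"

(* In the arguments below, the union of two index sets stands for the joint tuple. *)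

definition cond_ent :: "'i set \<Rightarrow> 'i set \<Rightarrow> 'i::finite info_expr" where
  "cond_ent S T = ent (S \<union> T) - ent T"

definition mut_info :: "'i set \<Rightarrow> 'i set \<Rightarrow> 'i::finite info_expr" where
  "mut_info S T = ent S + ent T - ent (S \<union> T)"

definition cond_mut_info :: "'i set \<Rightarrow> 'i set \<Rightarrow> 'i set \<Rightarrow> 'i::finite info_expr" where
  "cond_mut_info S T U = ent (S \<union> U) + ent (T \<union> U) - ent (S \<union> T \<union> U) - ent U"

definition ingleton :: "'i \<Rightarrow> 'i \<Rightarrow> 'i \<Rightarrow> 'i \<Rightarrow> 'i::finite info_expr" where
  "ingleton a b c d =
     cond_mut_info {c} {d} {a} + cond_mut_info {c} {d} {b} + mut_info {a} {b} - mut_info {c} {d}"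

(* The implication (all expressions in bs vanish \<Longrightarrow> a \<ge> 0) is essentially conditional: no choice
   of real multipliers turns it into an unconditional inequality. Validity of the implication
   itself is not part of this predicate. *)
definition essentially_conditional :: "'i::finite info_expr list \<Rightarrow> 'i info_expr \<Rightarrow> bool" where
  "essentially_conditional bs a \<longleftrightarrow>
     (\<forall>l :: nat \<Rightarrow> real. \<exists>M X. random_tuple M X \<and>
        info_value M X a + (\<Sum>i<length bs. l i * info_value M X (bs ! i)) < 0)"

datatype var4 = A\<^sub>4 | B\<^sub>4 | C\<^sub>4 | D\<^sub>4

datatype var5 = A\<^sub>5 | B\<^sub>5 | C\<^sub>5 | D\<^sub>5 | E\<^sub>5

lemma UNIV_var4: "UNIV = {A\<^sub>4, B\<^sub>4, C\<^sub>4, D\<^sub>4}"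
  using var4.exhaust by blast

lemma UNIV_var5: "UNIV = {A\<^sub>5, B\<^sub>5, C\<^sub>5, D\<^sub>5, E\<^sub>5}"
  using var5.exhaust by blast

instance var4 :: finite
  by standard (simp add: UNIV_var4)

instance var5 :: finite
  by standard (simp add: UNIV_var5)

lemma info_value_ent: "S \<noteq> {} \<Longrightarrow> info_value M X (ent S) = tuple_entropy M X S"
  by (simp add: info_value_def ent_def axis_def if_distrib[of "\<lambda>x. x * _"] cong: if_cong)

lemma info_value_add: "info_value M X (c + d) = info_value M X c + info_value M X d"
  by (simp add: info_value_def algebra_simps sum.distrib)

lemma info_value_diff: "info_value M X (c - d) = info_value M X c - info_value M X d"
  by (simp add: info_value_def algebra_simps sum_subtractf)

lemma essentially_conditional_two:
  "essentially_conditional [b1, b2] a \<longleftrightarrow>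
     (\<forall>l1 l2 :: real. \<exists>M X. random_tuple M X \<and>
        info_value M X a + l1 * info_value M X b1 + l2 * info_value M X b2 < 0)"
proof
  assume L: "essentially_conditional [b1, b2] a"
  show "\<forall>l1 l2 :: real. \<exists>M X. random_tuple M X \<and>
        info_value M X a + l1 * info_value M X b1 + l2 * info_value M X b2 < 0"
  proof (intro allI)
    fix l1 l2 :: real
    show "\<exists>M X. random_tuple M X \<and>
        info_value M X a + l1 * info_value M X b1 + l2 * info_value M X b2 < 0"
      using L[unfolded essentially_conditional_def, rule_format, of "\<lambda>i. if i = 0 then l1 else l2"]
      by (simp add: numeral_2_eq_2 add.assoc)
  qed
qed (simp add: essentially_conditional_def numeral_2_eq_2 add.assoc)

end

theory Submission
  imports Defs "HOL-Real_Asymp.Real_Asymp"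
begin

text \<open>For each implication there is a family of finite distributions, depending on a small \<open>e > 0\<close>, for
  which \<open>\<alpha>\<close> is negative of order \<open>e\<close> while both premises are \<open>O(e\<^sup>2)\<close> (for \<open>\<I>4\<close> and \<open>\<I>4'\<close>: order \<open>e\<^sup>2\<close>
  against \<open>O(e\<^sup>3)\<close>), so no multipliers can compensate. The entropies are computed in nats, as sums over
  atoms \<open>k\<close> of \<open>- p\<^sub>k ln P\<^sub>k\<close>, where \<open>P\<^sub>k\<close> is the mass of the atoms agreeing with \<open>k\<close> on the given variables.\<close>

section \<open>Finite distributions and their entropies in nats\<close>

definition finite_dist :: "real list \<Rightarrow> nat measure" where
  "finite_dist ps = point_measure {..<length ps} (\<lambda>k. ennreal (ps ! k))"

definition is_dist :: "real list \<Rightarrow> bool" where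
  "is_dist ps \<longleftrightarrow> (\<forall>x\<in>set ps. 0 \<le> x) \<and> sum_list ps = 1"

definition nat_entropy :: "real list \<Rightarrow> ('i \<Rightarrow> nat \<Rightarrow> nat) \<Rightarrow> 'i set \<Rightarrow> real" where
  "nat_entropy ps X S =
     - (\<Sum>k<length ps. ps ! k * ln (\<Sum>j<length ps. if \<forall>i\<in>S. X i j = X i k then ps ! j else 0))"

lemma space_finite_dist [simp]: "space (finite_dist ps) = {..<length ps}"
  by (simp add: finite_dist_def space_point_measure)

lemma sets_finite_dist [simp]: "sets (finite_dist ps) = Pow {..<length ps}"
  by (simp add: finite_dist_def sets_point_measure)

lemma prob_space_finite_dist:
  assumes "is_dist ps"
  shows "prob_space (finite_dist ps)"
  unfolding finite_dist_def
proof (rule prob_space_point_measure)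
  show "(\<Sum>k<length ps. ennreal (ps ! k)) = 1"
    using assms
    by (subst sum_ennreal)
       (auto simp: is_dist_def sum_list_sum_nth atLeast0LessThan)
qed (use assms in \<open>auto simp: is_dist_def\<close>)

lemma simple_function_finite_dist: "simple_function (finite_dist ps) f"
  by (auto simp: simple_function_def)

lemma measure_finite_dist:
  assumes "is_dist ps" "E \<subseteq> {..<length ps}"
  shows "measure (finite_dist ps) E = (\<Sum>k\<in>E. ps ! k)"
proof -
  have "ps ! k \<ge> 0" if "k \<in> E" for k
    using assms that by (auto simp: is_dist_def)
  then show ?thesis
    using assms(2) unfolding finite_dist_def measure_def
    by (subst emeasure_point_measure_finite) (auto simp: sum_nonneg)
qed

lemma random_tuple_finite_dist: "is_dist ps \<Longrightarrow> random_tuple (finite_dist ps) X"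
  by (simp add: random_tuple_def prob_space_finite_dist simple_function_finite_dist)

lemma subtuple_eq_iff: "subtuple X S j = subtuple X S k \<longleftrightarrow> (\<forall>i\<in>S. X i j = X i k)"
  by (auto simp: subtuple_def restrict_def fun_eq_iff)

lemma tuple_entropy_finite_dist:
  fixes X :: "'i::finite \<Rightarrow> nat \<Rightarrow> nat"
  assumes "is_dist ps"
  shows "tuple_entropy (finite_dist ps) X S = nat_entropy ps X S / ln 2"
proof -
  define P where "P y = (\<Sum>j | j < length ps \<and> subtuple X S j = y. ps ! j)" for y
  interpret prob_space "finite_dist ps"
    using assms by (rule prob_space_finite_dist)
  interpret information_space "finite_dist ps" 2
    by standard simp
  have "simple_distributed (finite_dist ps) (subtuple X S) P"
  proof (rule simple_distributedI[OF simple_function_finite_dist])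
    show "0 \<le> P y" for y
      using assms by (auto simp: P_def is_dist_def intro!: sum_nonneg)
    show "P y = prob (subtuple X S -` {y} \<inter> space (finite_dist ps))" for y
      using assms
      by (subst measure_finite_dist) (auto simp: P_def intro!: sum.cong)
  qed
  then have "tuple_entropy (finite_dist ps) X S =
      - (\<Sum>y\<in>subtuple X S ` {..<length ps}. P y * log 2 (P y))"
    unfolding tuple_entropy_def by (subst entropy_simple_distributed) simp_all
  \<comment> \<open>The atoms are grouped into the fibres of \<open>subtuple X S\<close>; on a fibre
    the logarithm is constant and the weights add up to \<open>P y\<close>.\<close>
  also have "(\<Sum>y\<in>subtuple X S ` {..<length ps}. P y * log 2 (P y)) =
      (\<Sum>k<length ps. ps ! k * log 2 (P (subtuple X S k)))"
    by (rule sym, rule trans[OF sum.image_gen[where g = "subtuple X S"]])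
       (auto simp: P_def sum_distrib_right intro!: sum.cong)
  also have "\<dots> = (\<Sum>k<length ps. ps ! k *
      ln (\<Sum>j<length ps. if \<forall>i\<in>S. X i j = X i k then ps ! j else 0)) / ln 2"
    by (simp add: P_def subtuple_eq_iff log_def sum_divide_distrib sum.If_cases Int_def)
  finally show ?thesis
    by (simp add: nat_entropy_def)
qed

text \<open>Prepares tuples in which a variable is repeated: equal coordinates merge in the image of
  the index set.\<close>

lemma nat_entropy_comp: "nat_entropy ps (\<lambda>i. X (f i)) S = nat_entropy ps X (f ` S)"
  by (simp add: nat_entropy_def)

section \<open>Information expressions in nats and the reduction to asymptotics\<close>

definition nat_info_value :: "real list \<Rightarrow> ('i::finite \<Rightarrow> nat \<Rightarrow> nat) \<Rightarrow> 'i info_expr \<Rightarrow> real" where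
  "nat_info_value ps X c = (\<Sum>S | S \<noteq> {}. c $ S * nat_entropy ps X S)"

lemma info_value_finite_dist:
  "is_dist ps \<Longrightarrow> info_value (finite_dist ps) X c = nat_info_value ps X c / ln 2"
  by (simp add: info_value_def nat_info_value_def tuple_entropy_finite_dist sum_divide_distrib)

lemma nat_info_value_ent: "S \<noteq> {} \<Longrightarrow> nat_info_value ps X (ent S) = nat_entropy ps X S"
  by (simp add: nat_info_value_def ent_def axis_def if_distrib[of "\<lambda>x. x * _"] cong: if_cong)

lemma nat_info_value_add: "nat_info_value ps X (c + d) = nat_info_value ps X c + nat_info_value ps X d"
  by (simp add: nat_info_value_def algebra_simps sum.distrib)

lemma nat_info_value_diff: "nat_info_value ps X (c - d) = nat_info_value ps X c - nat_info_value ps X d"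
  by (simp add: nat_info_value_def algebra_simps sum_subtractf)

lemma nat_info_value_minus: "nat_info_value ps X (- c) = - nat_info_value ps X c"
  by (simp add: nat_info_value_def sum_negf)

lemmas nat_info_value_simps = ingleton_def cond_mut_info_def mut_info_def cond_ent_def
  nat_info_value_add nat_info_value_diff nat_info_value_minus nat_info_value_ent

text \<open>One family serves all multipliers; only how small \<open>e\<close> must be depends on
  \<open>l1\<close> and \<open>l2\<close>. Passing from nats to bits divides by
  \<open>ln 2 > 0\<close> and keeps the sign.\<close>

lemma essentially_conditionalI:
  fixes p :: "real \<Rightarrow> real list" and X :: "'i::finite \<Rightarrow> nat \<Rightarrow> nat"
  assumes dist: "\<forall>\<^sub>F e in at_right 0. is_dist (p e)"
    and neg: "\<And>l1 l2. \<forall>\<^sub>F e in at_right 0. nat_info_value (p e) X a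
        + l1 * nat_info_value (p e) X b1 + l2 * nat_info_value (p e) X b2 < 0"
  shows "essentially_conditional [b1, b2] a"
  unfolding essentially_conditional_two
proof (intro allI)
  fix l1 l2 :: real
  have "\<exists>e. is_dist (p e) \<and> nat_info_value (p e) X a
      + l1 * nat_info_value (p e) X b1 + l2 * nat_info_value (p e) X b2 < 0"
    using eventually_happens'[OF trivial_limit_at_right_real eventually_conj[OF dist neg]] .
  then obtain e where e: "is_dist (p e)"
    "nat_info_value (p e) X a + l1 * nat_info_value (p e) X b1 + l2 * nat_info_value (p e) X b2 < 0"
    by blast
  have "info_value (finite_dist (p e)) X a + l1 * info_value (finite_dist (p e)) X b1
      + l2 * info_value (finite_dist (p e)) X b2 =
      (nat_info_value (p e) X a + l1 * nat_info_value (p e) X b1 + l2 * nat_info_value (p e) X b2) / ln 2"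
    by (simp add: info_value_finite_dist[OF e(1)] add_divide_distrib)
  with e(2) have "info_value (finite_dist (p e)) X a + l1 * info_value (finite_dist (p e)) X b1
      + l2 * info_value (finite_dist (p e)) X b2 < 0"
    by (simp add: divide_neg_pos)
  then show "\<exists>M X. random_tuple M X \<and>
      info_value M X a + l1 * info_value M X b1 + l2 * info_value M X b2 < 0"
    using random_tuple_finite_dist[OF e(1)] by blast
qed

section \<open>Tables of outcomes and logarithms of marginal probabilities\<close>

fun columns :: "nat list \<Rightarrow> nat list \<Rightarrow> nat list \<Rightarrow> nat list \<Rightarrow> var4 \<Rightarrow> nat \<Rightarrow> nat" where
  "columns as bs cs ds A\<^sub>4 k = as ! k"
| "columns as bs cs ds B\<^sub>4 k = bs ! k"
| "columns as bs cs ds C\<^sub>4 k = cs ! k"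
| "columns as bs cs ds D\<^sub>4 k = ds ! k"

text \<open>Applied by \<open>rule\<close>, this leaves a rational identity and positivity goals.
  Some later equations carry a term \<open>ln 1\<close> so that they fit this pattern.\<close>

lemma ln_quotient: "y = x / c \<Longrightarrow> 0 < x \<Longrightarrow> 0 < c \<Longrightarrow> ln y = ln x - ln c" for x y c :: real
  by (simp add: ln_div)

lemma ln_mult_quotient:
  "y = x * z / c \<Longrightarrow> 0 < x \<Longrightarrow> 0 < z \<Longrightarrow> 0 < c \<Longrightarrow> ln y = ln x + ln z - ln c" for x y z c :: real
  by (simp add: ln_div ln_mult)

text \<open>Used backwards: \<open>2 * ln 2\<close> becomes the single logarithm that the quotient
  rules can match.\<close>

lemma ln_4: "ln 4 = 2 * ln (2 :: real)"
  using ln_realpow[of 2 2] by simp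

section \<open>The family for I1\<close>

text \<open>Here \<open>A\<close>, \<open>B\<close> are independent given \<open>C\<close> and nearly independent unconditionally,
  and \<open>C\<close>, \<open>D\<close> are independent given \<open>A\<close> and given \<open>B\<close>. At \<open>e = 0\<close> the variable \<open>C\<close> is constant.\<close>

definition weights_I1 :: "real \<Rightarrow> real list" where
  "weights_I1 e = [(1 - e) / 4, (1 - e) / 4, (1 - e) / 4, (1 - e) / 4, e]"

definition vars_I1 :: "var4 \<Rightarrow> nat \<Rightarrow> nat" where
  "vars_I1 = columns [0, 0, 1, 1, 1] [0, 1, 0, 1, 0] [0, 0, 0, 0, 1] [1, 0, 1, 1, 1]"

lemma is_dist_weights_I1:
  assumes "0 < e" "e < 1"
  shows "is_dist (weights_I1 e)"
  using assms
  by (auto simp: is_dist_def weights_I1_def; simp add: field_simps power2_eq_square)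

text \<open>The left-hand sides are the forms in which the simplifier leaves the marginal probabilities.\<close>

lemma ln_eqs_I1:
  fixes e :: real
  assumes e: "0 < e" "e < 1"
  shows
    "ln ((1 - e) / 4) = ln (1 - e) - 2 * ln 2"
    "ln ((3 - 3 * e) / 4 + (1 - e) / 4) = ln (1 - e) - ln 1"
    "ln ((1 - e) / 2) = ln (1 - e) - ln 2"
    "ln ((1 - e) / 2 + e) = ln (1 + e) - ln 2"
    "ln ((1 - e) / 4 + e) = ln (1 + 3 * e) - 2 * ln 2"
    "ln ((3 - 3 * e) / 4) = ln (1 - e) - ln (4 / 3)"
    "ln ((3 - 3 * e) / 4 + e) = ln (1 + e / 3) - ln (4 / 3)"
  unfolding ln_4[symmetric]
  by (rule ln_quotient ln_mult_quotient;
      use e in \<open>simp add: add_pos_nonneg field_simps power2_eq_square\<close>)+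

text \<open>By the independences of \<open>C\<close> and \<open>D\<close> given \<open>A\<close> and
  given \<open>B\<close>, the Ingleton expression is I(A:B) - I(C:D). The event C = 1, of mass
  \<open>e\<close>, forces D = 1, whose probability is near 3/4; this produces the term
  \<open>e * ln (4 / 3)\<close>.\<close>

lemma info_values_I1:
  assumes e: "0 < e" "e < 1"
  shows
    "nat_info_value (weights_I1 e) vars_I1 (ingleton A\<^sub>4 B\<^sub>4 C\<^sub>4 D\<^sub>4) =
     (1 + 3 * e) / 4 * ln (1 + 3 * e) - (1 + e) * ln (1 + e)
     + (3 + e) / 4 * ln (1 + e / 3) - e * ln (4 / 3)"
    "nat_info_value (weights_I1 e) vars_I1 (cond_mut_info {A\<^sub>4} {B\<^sub>4} {C\<^sub>4}) = 0"
    "nat_info_value (weights_I1 e) vars_I1 (mut_info {A\<^sub>4} {B\<^sub>4}) =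
     (1 + 3 * e) / 4 * ln (1 + 3 * e) - (1 - e) / 4 * ln (1 - e) - (1 + e) * ln (1 + e)"
  by (simp add: nat_info_value_simps;
      simp add: nat_entropy_def weights_I1_def vars_I1_def ln_eqs_I1[OF e];
      simp add: field_simps power2_eq_square)+

lemma eventually_is_dist_I1: "\<forall>\<^sub>F e in at_right 0. is_dist (weights_I1 e)"
  using eventually_at_right_real[of 0 1, simplified]
  by (rule eventually_mono) (auto intro: is_dist_weights_I1)

lemma eventually_neg_I1:
  fixes l1 l2 :: real
  shows "\<forall>\<^sub>F e in at_right 0. nat_info_value (weights_I1 e) vars_I1 (ingleton A\<^sub>4 B\<^sub>4 C\<^sub>4 D\<^sub>4)
    + l1 * nat_info_value (weights_I1 e) vars_I1 (cond_mut_info {A\<^sub>4} {B\<^sub>4} {C\<^sub>4})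
    + l2 * nat_info_value (weights_I1 e) vars_I1 (mut_info {A\<^sub>4} {B\<^sub>4}) < 0"
proof -
  have "\<forall>\<^sub>F e::real in at_right 0. e \<in> {0<..<1}"
    by (rule eventually_at_right_real) simp
  moreover have "\<forall>\<^sub>F e in at_right 0.
     (1 + 3 * e) / 4 * ln (1 + 3 * e) - (1 + e) * ln (1 + e)
     + (3 + e) / 4 * ln (1 + e / 3) - e * ln (4 / 3)
     + l2 * ((1 + 3 * e) / 4 * ln (1 + 3 * e) - (1 - e) / 4 * ln (1 - e) - (1 + e) * ln (1 + e)) < 0"
    \<comment> \<open>The linear terms of the logarithms cancel, leaving
      \<open>- e * ln (4 / 3)\<close>; the factor of \<open>l2\<close> has no linear term.\<close>
    by real_asymp
  ultimately show ?thesis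
    by eventually_elim (simp add: info_values_I1)
qed

section \<open>The family for I2\<close>

text \<open>At \<open>e = 0\<close> one has \<open>A = D\<close> whenever \<open>C = 0\<close>; the perturbation keeps the joint law of \<open>(A, B, C)\<close>
  and moves mass \<open>e\<close> from \<open>D = 1\<close> to \<open>D = 0\<close>.\<close>

definition weights_I2 :: "real \<Rightarrow> real list" where
  "weights_I2 e = [1/5, 1/5, 1/5, 1/5 - e, 1/5, e]"

definition vars_I2 :: "var4 \<Rightarrow> nat \<Rightarrow> nat" where
  "vars_I2 = columns [0, 1, 0, 1, 0, 1] [0, 1, 1, 0, 0, 0] [1, 0, 0, 0, 0, 0] [0, 1, 0, 1, 0, 0]"

lemma is_dist_weights_I2:
  assumes "0 < e" "e < 1/5"
  shows "is_dist (weights_I2 e)"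
  using assms
  by (auto simp: is_dist_def weights_I2_def; simp add: field_simps power2_eq_square)

lemma ln_eqs_I2:
  fixes e :: real
  assumes e: "0 < e" "e < 1/5"
  shows
    "ln (1 / 5 :: real) = ln 1 - ln 5"
    "ln (2 / 5 :: real) = ln 2 - ln 5"
    "ln (4 / 5 :: real) = 2 * ln 2 - ln 5"
    "ln (3 / 5 :: real) = ln 3 - ln 5"
    "ln (4 / 3 :: real) = 2 * ln 2 - ln 3"
    "ln (1 / 5 - e) = ln (1 - 5 * e) - ln 5"
    "ln (1 / 5 + e) = ln (1 + 5 * e) - ln 5"
    "ln (2 / 5 - e) = ln (1 - 5 / 2 * e) + ln 2 - ln 5"
    "ln (2 / 5 + e) = ln (1 + 5 / 2 * e) + ln 2 - ln 5"
    "ln (3 / 5 + e) = ln (1 + 5 / 3 * e) + ln 3 - ln 5"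
  unfolding ln_4[symmetric]
  by (rule ln_quotient ln_mult_quotient;
      use e in \<open>simp add: add_pos_nonneg field_simps power2_eq_square\<close>)+

text \<open>I(C:D|A) = 0 since A = 0 forces D = 0 and A = 1 forces C = 0. At \<open>e = 0\<close>
  one has D = A everywhere, so by the chain rule the Ingleton expression equals I(A:B|C) = 0
  there.\<close>

lemma info_values_I2:
  assumes e: "0 < e" "e < 1/5"
  shows
    "nat_info_value (weights_I2 e) vars_I2 (ingleton A\<^sub>4 B\<^sub>4 C\<^sub>4 D\<^sub>4) =
     (1/5 + e) * ln (1 + 5 * e) - 2 * (2/5 + e) * ln (1 + 5 / 2 * e) + (3/5 + e) * ln (1 + 5 / 3 * e)
     - e * ln (4 / 3)"
    "nat_info_value (weights_I2 e) vars_I2 (cond_mut_info {A\<^sub>4} {B\<^sub>4} {C\<^sub>4}) = 0"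
    "nat_info_value (weights_I2 e) vars_I2 (cond_mut_info {B\<^sub>4} {D\<^sub>4} {C\<^sub>4}) =
     (1/5 - e) * ln (1 - 5 * e) + (1/5 + e) * ln (1 + 5 * e)
     - (2/5 - e) * ln (1 - 5 / 2 * e) - (2/5 + e) * ln (1 + 5 / 2 * e)"
  by (simp add: nat_info_value_simps;
      simp add: nat_entropy_def weights_I2_def vars_I2_def ln_eqs_I2[OF e];
      simp add: field_simps power2_eq_square)+

lemma eventually_is_dist_I2: "\<forall>\<^sub>F e in at_right 0. is_dist (weights_I2 e)"
  using eventually_at_right_real[of 0 "1/5", simplified]
  by (rule eventually_mono) (auto intro: is_dist_weights_I2)

lemma eventually_neg_I2:
  fixes l1 l2 :: real
  shows "\<forall>\<^sub>F e in at_right 0. nat_info_value (weights_I2 e) vars_I2 (ingleton A\<^sub>4 B\<^sub>4 C\<^sub>4 D\<^sub>4)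
    + l1 * nat_info_value (weights_I2 e) vars_I2 (cond_mut_info {A\<^sub>4} {B\<^sub>4} {C\<^sub>4})
    + l2 * nat_info_value (weights_I2 e) vars_I2 (cond_mut_info {B\<^sub>4} {D\<^sub>4} {C\<^sub>4}) < 0"
proof -
  have "\<forall>\<^sub>F e::real in at_right 0. e \<in> {0<..<1/5}"
    by (rule eventually_at_right_real) simp
  moreover have "\<forall>\<^sub>F e in at_right 0.
     (1/5 + e) * ln (1 + 5 * e) - 2 * (2/5 + e) * ln (1 + 5 / 2 * e) + (3/5 + e) * ln (1 + 5 / 3 * e)
     - e * ln (4 / 3)
     + l2 * ((1/5 - e) * ln (1 - 5 * e) + (1/5 + e) * ln (1 + 5 * e)
     - (2/5 - e) * ln (1 - 5 / 2 * e) - (2/5 + e) * ln (1 + 5 / 2 * e)) < 0"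
    \<comment> \<open>The linear part is \<open>e - 2 * e + e - e * ln (4 / 3)\<close>; in the
      factor of \<open>l2\<close> it cancels.\<close>
    by real_asymp
  ultimately show ?thesis
    by eventually_elim (simp add: info_values_I2)
qed

section \<open>The family for I3\<close>

definition weights_I3 :: "real \<Rightarrow> real list" where
  "weights_I3 e = [1/2 - e, 1/2 - e, e, e]"

text \<open>\<open>C\<close> is the disjunction and \<open>D\<close> the conjunction of the bits
  \<open>A\<close> and \<open>B\<close>, so H(C|A,B) = 0 for every \<open>e\<close>. Given C = 1
  only the value A = B = 0 is missing, where independence would put mass of order
  \<open>e\<^sup>2\<close>.\<close>

definition vars_I3 :: "var4 \<Rightarrow> nat \<Rightarrow> nat" where
  "vars_I3 = columns [1, 0, 1, 0] [1, 0, 0, 1] [1, 0, 1, 1] [1, 0, 0, 0]"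

lemma is_dist_weights_I3:
  assumes "0 < e" "e < 1/2"
  shows "is_dist (weights_I3 e)"
  using assms
  by (auto simp: is_dist_def weights_I3_def; simp add: field_simps power2_eq_square)

text \<open>Shared by two families with the same weights. The terms with \<open>ln e\<close> cancel
  in all the values computed from them.\<close>

lemma ln_eqs_I3_I5:
  fixes e :: real
  assumes e: "0 < e" "e < 1/2"
  shows
    "ln (1 / 2 :: real) = ln 1 - ln 2"
    "ln (1 / 2 - e) = ln (1 - 2 * e) - ln 2"
    "ln (1 / 2 + e) = ln (1 + 2 * e) - ln 2"
    "ln (2 * e) = ln e + ln 2 - ln 1"
  by (rule ln_quotient ln_mult_quotient;
      use e in \<open>simp add: add_pos_nonneg field_simps power2_eq_square\<close>)+

lemma info_values_I3:
  assumes e: "0 < e" "e < 1/2"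
  shows
    "nat_info_value (weights_I3 e) vars_I3 (ingleton A\<^sub>4 B\<^sub>4 C\<^sub>4 D\<^sub>4) =
     (1 + 2 * e) * ln (1 + 2 * e) + (1 - 2 * e) * ln (1 - 2 * e) - 2 * e * ln 2"
    "nat_info_value (weights_I3 e) vars_I3 (cond_mut_info {A\<^sub>4} {B\<^sub>4} {C\<^sub>4}) =
     (1/2 - e) * ln (1 - 2 * e) + (1/2 + e) * ln (1 + 2 * e)"
    "nat_info_value (weights_I3 e) vars_I3 (cond_ent {C\<^sub>4} {A\<^sub>4, B\<^sub>4}) = 0"
  by (simp add: nat_info_value_simps;
      simp add: nat_entropy_def weights_I3_def vars_I3_def ln_eqs_I3_I5[OF e];
      simp add: field_simps power2_eq_square)+

lemma eventually_is_dist_I3: "\<forall>\<^sub>F e in at_right 0. is_dist (weights_I3 e)"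
  using eventually_at_right_real[of 0 "1/2", simplified]
  by (rule eventually_mono) (auto intro: is_dist_weights_I3)

lemma eventually_neg_I3:
  fixes l1 l2 :: real
  shows "\<forall>\<^sub>F e in at_right 0. nat_info_value (weights_I3 e) vars_I3 (ingleton A\<^sub>4 B\<^sub>4 C\<^sub>4 D\<^sub>4)
    + l1 * nat_info_value (weights_I3 e) vars_I3 (cond_mut_info {A\<^sub>4} {B\<^sub>4} {C\<^sub>4})
    + l2 * nat_info_value (weights_I3 e) vars_I3 (cond_ent {C\<^sub>4} {A\<^sub>4, B\<^sub>4}) < 0"
proof -
  have "\<forall>\<^sub>F e::real in at_right 0. e \<in> {0<..<1/2}"
    by (rule eventually_at_right_real) simp
  moreover have "\<forall>\<^sub>F e in at_right 0.
     (1 + 2 * e) * ln (1 + 2 * e) + (1 - 2 * e) * ln (1 - 2 * e) - 2 * e * ln 2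
     + l1 * ((1/2 - e) * ln (1 - 2 * e) + (1/2 + e) * ln (1 + 2 * e)) < 0"
    \<comment> \<open>The linear terms of the logarithms cancel, so \<open>- 2 * e * ln 2\<close>
      dominates.\<close>
    by real_asymp
  ultimately show ?thesis
    by eventually_elim (simp add: info_values_I3)
qed

section \<open>The family for I4 and I4'\<close>

text \<open>Given \<open>B\<close>, the variables \<open>C\<close> and \<open>D\<close> are independent. The rare event \<open>A = 1\<close>, of probability \<open>e\<^sup>2\<close>,
  supplies exactly the mass that this independence requires at \<open>B = C = D = 1\<close>.\<close>

definition weights_I4 :: "real \<Rightarrow> real list" where
  "weights_I4 e = [(1 - e)\<^sup>2 / 2, e * (1 - e) / 2, e * (1 - e) / 2, e\<^sup>2 / 2, (1 - e\<^sup>2) / 2, e\<^sup>2 / 2]"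

definition vars_I4 :: "var4 \<Rightarrow> nat \<Rightarrow> nat" where
  "vars_I4 = columns [0, 0, 0, 1, 0, 1] [1, 1, 1, 1, 0, 0] [0, 0, 1, 1, 1, 1] [0, 1, 0, 1, 1, 1]"

lemma is_dist_weights_I4:
  assumes "0 < e" "e < 1"
  shows "is_dist (weights_I4 e)"
  using assms
  by (auto simp: is_dist_def weights_I4_def power_le_one; simp add: field_simps power2_eq_square)

lemma ln_eqs_I4:
  fixes e :: real
  assumes e: "0 < e" "e < 1"
  shows
    "ln ((1 - e\<^sup>2) / 2) = ln (1 - e) + ln (1 + e) - ln 2"
    "ln (e\<^sup>2 + (e * (1 - e) / 2 + (1 - e\<^sup>2) / 2)) = ln (1 + e) - ln 2"
    "ln (e * (1 - e) / 2 + (1 - e\<^sup>2) / 2) = ln (1 - e) + ln (1 + 2 * e) - ln 2"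
    "ln (e\<^sup>2 + (1 - e\<^sup>2) / 2) = ln (1 + e\<^sup>2) - ln 2"
    "ln ((1 - e\<^sup>2) / 2 + e\<^sup>2 / 2) = ln 1 - ln 2"
    "ln (e * (1 - e) + (1 - e)\<^sup>2 / 2) = ln (1 - e) + ln (1 + e) - ln 2"
    "ln (e\<^sup>2 / 2) = ln e + ln e - ln 2"
    "ln (e\<^sup>2) = ln e + ln e - ln 1"
    "ln (e * (1 - e) / 2) = ln e + ln (1 - e) - ln 2"
    "ln ((1 - e)\<^sup>2 / 2) = ln (1 - e) + ln (1 - e) - ln 2"
    "ln (e * (1 - e) / 2 + e\<^sup>2 / 2) = ln e - ln 2"
    "ln ((1 - e)\<^sup>2 / 2 + e * (1 - e) / 2) = ln (1 - e) - ln 2"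
  by (rule ln_quotient ln_mult_quotient;
      use e in \<open>simp add: add_pos_nonneg field_simps power2_eq_square\<close>)+

text \<open>\<open>A\<close> and \<open>B\<close> are independent and I(C:D|B) = 0, so the Ingleton
  expression is I(C:D|A) - I(C:D) = I(A:D|C) - I(A:D) by the chain rule; the two outer brackets are
  these terms. A = 1 forces D = 1, of probability near 1/2, so I(A:D) is about
  \<open>e\<^sup>2 * ln 2\<close>; given C = 1, D = 1 is already almost sure, so I(A:D|C) is of
  order \<open>e\<^sup>3\<close>. The law is symmetric in \<open>C\<close> and \<open>D\<close>,
  hence both premises agree.\<close>

lemma info_values_I4:
  assumes e: "0 < e" "e < 1"
  shows
    "nat_info_value (weights_I4 e) vars_I4 (ingleton A\<^sub>4 B\<^sub>4 C\<^sub>4 D\<^sub>4) =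
     ((1 - e\<^sup>2) / 2 * (ln (1 - e) + ln (1 + e)) + (1 + e) / 2 * ln (1 + e)
     - (1 + e\<^sup>2) / 2 * ln (1 + e\<^sup>2) - (1 - e) * (1 + 2 * e) / 2 * (ln (1 - e) + ln (1 + 2 * e)))
     - (e\<^sup>2 * (ln 2 - ln (1 + e)) + (1 - e) * (1 + 2 * e) / 2 * (ln (1 + 2 * e) - 2 * ln (1 + e))
     - (1 - e) / 2 * (ln (1 - e) + ln (1 + e)))"
    "nat_info_value (weights_I4 e) vars_I4 (cond_mut_info {A\<^sub>4} {D\<^sub>4} {C\<^sub>4}) =
     (1 - e\<^sup>2) / 2 * (ln (1 - e) + ln (1 + e)) + (1 + e) / 2 * ln (1 + e)
     - (1 + e\<^sup>2) / 2 * ln (1 + e\<^sup>2) - (1 - e) * (1 + 2 * e) / 2 * (ln (1 - e) + ln (1 + 2 * e))"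
    "nat_info_value (weights_I4 e) vars_I4 (cond_mut_info {A\<^sub>4} {C\<^sub>4} {D\<^sub>4}) =
     (1 - e\<^sup>2) / 2 * (ln (1 - e) + ln (1 + e)) + (1 + e) / 2 * ln (1 + e)
     - (1 + e\<^sup>2) / 2 * ln (1 + e\<^sup>2) - (1 - e) * (1 + 2 * e) / 2 * (ln (1 - e) + ln (1 + 2 * e))"
  by (simp add: nat_info_value_simps;
      simp add: nat_entropy_def weights_I4_def vars_I4_def ln_eqs_I4[OF e];
      simp add: field_simps power2_eq_square)+

lemma eventually_is_dist_I4: "\<forall>\<^sub>F e in at_right 0. is_dist (weights_I4 e)"
  using eventually_at_right_real[of 0 1, simplified]
  by (rule eventually_mono) (auto intro: is_dist_weights_I4)

lemma eventually_neg_I4: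
  fixes l1 l2 :: real
  shows "\<forall>\<^sub>F e in at_right 0. nat_info_value (weights_I4 e) vars_I4 (ingleton A\<^sub>4 B\<^sub>4 C\<^sub>4 D\<^sub>4)
    + l1 * nat_info_value (weights_I4 e) vars_I4 (cond_mut_info {A\<^sub>4} {D\<^sub>4} {C\<^sub>4})
    + l2 * nat_info_value (weights_I4 e) vars_I4 (cond_mut_info {A\<^sub>4} {C\<^sub>4} {D\<^sub>4}) < 0"
proof -
  have "\<forall>\<^sub>F e::real in at_right 0. e \<in> {0<..<1}"
    by (rule eventually_at_right_real) simp
  moreover have "\<forall>\<^sub>F e in at_right 0.
     ((1 - e\<^sup>2) / 2 * (ln (1 - e) + ln (1 + e)) + (1 + e) / 2 * ln (1 + e)
     - (1 + e\<^sup>2) / 2 * ln (1 + e\<^sup>2) - (1 - e) * (1 + 2 * e) / 2 * (ln (1 - e) + ln (1 + 2 * e)))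
     - (e\<^sup>2 * (ln 2 - ln (1 + e)) + (1 - e) * (1 + 2 * e) / 2 * (ln (1 + 2 * e) - 2 * ln (1 + e))
     - (1 - e) / 2 * (ln (1 - e) + ln (1 + e)))
     + l1 * ((1 - e\<^sup>2) / 2 * (ln (1 - e) + ln (1 + e)) + (1 + e) / 2 * ln (1 + e)
     - (1 + e\<^sup>2) / 2 * ln (1 + e\<^sup>2) - (1 - e) * (1 + 2 * e) / 2 * (ln (1 - e) + ln (1 + 2 * e)))
     + l2 * ((1 - e\<^sup>2) / 2 * (ln (1 - e) + ln (1 + e)) + (1 + e) / 2 * ln (1 + e)
     - (1 + e\<^sup>2) / 2 * ln (1 + e\<^sup>2) - (1 - e) * (1 + 2 * e) / 2 * (ln (1 - e) + ln (1 + 2 * e))) < 0"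
    by real_asymp
  ultimately show ?thesis
    by eventually_elim (simp add: info_values_I4)
qed

section \<open>The family for I5, I5' and I6\<close>

definition weights_I5 :: "real \<Rightarrow> real list" where
  "weights_I5 e = [1/2 - e, 1/2 - e, e, e]"

text \<open>\<open>A\<close> and \<open>B\<close> are independent, D = 1 exactly if A = B = 1, and C
  = 1 exactly if A = B = 0. Fixing \<open>A\<close> or \<open>B\<close> makes \<open>C\<close> or
  \<open>D\<close> constant. Given D = 0 only the value B = C = 1 is missing, where independence
  would put mass of order \<open>e\<^sup>2\<close>.\<close>

definition vars_I5 :: "var4 \<Rightarrow> nat \<Rightarrow> nat" where
  "vars_I5 = columns [1, 1, 0, 0] [0, 1, 0, 1] [0, 0, 1, 0] [0, 1, 0, 0]"

lemma is_dist_weights_I5: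
  assumes "0 < e" "e < 1/2"
  shows "is_dist (weights_I5 e)"
  using assms
  by (auto simp: is_dist_def weights_I5_def; simp add: field_simps power2_eq_square)

text \<open>Of the four terms of the Ingleton expression only - I(C:D) survives; it is about
  \<open>- e * ln 2\<close>.\<close>

lemma info_values_I5:
  assumes e: "0 < e" "e < 1/2"
  shows
    "nat_info_value (weights_I5 e) vars_I5 (ingleton A\<^sub>4 B\<^sub>4 C\<^sub>4 D\<^sub>4) =
     (1 - e) * ln (1 - e) + (1/2 + e) * ln (1 + 2 * e) - e * ln 2"
    "nat_info_value (weights_I5 e) vars_I5 (cond_mut_info {B\<^sub>4} {C\<^sub>4} {D\<^sub>4}) =
     (1/2 - e) * ln (1 - 2 * e) + (1/2 + e) * ln (1 + 2 * e)"
    "nat_info_value (weights_I5 e) vars_I5 (cond_mut_info {C\<^sub>4} {D\<^sub>4} {B\<^sub>4}) = 0"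
  by (simp add: nat_info_value_simps;
      simp add: nat_entropy_def weights_I5_def vars_I5_def ln_eqs_I3_I5[OF e];
      simp add: field_simps power2_eq_square)+

lemma eventually_is_dist_I5: "\<forall>\<^sub>F e in at_right 0. is_dist (weights_I5 e)"
  using eventually_at_right_real[of 0 "1/2", simplified]
  by (rule eventually_mono) (auto intro: is_dist_weights_I5)

lemma eventually_neg_I5:
  fixes l1 l2 :: real
  shows "\<forall>\<^sub>F e in at_right 0. nat_info_value (weights_I5 e) vars_I5 (ingleton A\<^sub>4 B\<^sub>4 C\<^sub>4 D\<^sub>4)
    + l1 * nat_info_value (weights_I5 e) vars_I5 (cond_mut_info {B\<^sub>4} {C\<^sub>4} {D\<^sub>4})
    + l2 * nat_info_value (weights_I5 e) vars_I5 (cond_mut_info {C\<^sub>4} {D\<^sub>4} {B\<^sub>4}) < 0"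
proof -
  have "\<forall>\<^sub>F e::real in at_right 0. e \<in> {0<..<1/2}"
    by (rule eventually_at_right_real) simp
  moreover have "\<forall>\<^sub>F e in at_right 0.
     (1 - e) * ln (1 - e) + (1/2 + e) * ln (1 + 2 * e) - e * ln 2
     + l1 * ((1/2 - e) * ln (1 - 2 * e) + (1/2 + e) * ln (1 + 2 * e)) < 0"
    by real_asymp
  ultimately show ?thesis
    by eventually_elim (simp add: info_values_I5)
qed

section \<open>Passage to five variables\<close>

text \<open>Taking \<open>E\<close> to be a copy of one of the other variables makes the two additional
  terms of the five-variable inequalities vanish.\<close>

fun copy_var :: "var4 \<Rightarrow> var5 \<Rightarrow> var4" where
  "copy_var v A\<^sub>5 = A\<^sub>4"
| "copy_var v B\<^sub>5 = B\<^sub>4"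
| "copy_var v C\<^sub>5 = C\<^sub>4"
| "copy_var v D\<^sub>5 = D\<^sub>4"
| "copy_var v E\<^sub>5 = v"

lemma nat_info_value_copy_var:
  "nat_info_value ps (\<lambda>i. X (copy_var v i)) (ingleton A\<^sub>5 B\<^sub>5 C\<^sub>5 D\<^sub>5) =
     nat_info_value ps X (ingleton A\<^sub>4 B\<^sub>4 C\<^sub>4 D\<^sub>4)"
  "nat_info_value ps (\<lambda>i. X (copy_var v i)) (cond_mut_info {x} {y} {z}) =
     nat_info_value ps X (cond_mut_info {copy_var v x} {copy_var v y} {copy_var v z})"
  by (simp_all add: nat_info_value_simps nat_entropy_comp)

lemma nat_info_value_cond_mut_info_self:
  "nat_info_value ps X (cond_mut_info {x} {y} {x}) = 0"
  "nat_info_value ps X (cond_mut_info {x} {y} {y}) = 0"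
  \<comment> \<open>The instance at \<open>0\<close> covers entropies that cancel before
    evaluation.\<close>
  by (simp_all add: nat_info_value_simps nat_info_value_def[of _ _ 0] insert_commute)

theorem theorem3:
  shows "(essentially_conditional
        [cond_mut_info {A\<^sub>4} {B\<^sub>4} {C\<^sub>4}, mut_info {A\<^sub>4} {B\<^sub>4}]
        (ingleton A\<^sub>4 B\<^sub>4 C\<^sub>4 D\<^sub>4)) \<and>
     (essentially_conditional
        [cond_mut_info {A\<^sub>4} {B\<^sub>4} {C\<^sub>4}, cond_mut_info {B\<^sub>4} {D\<^sub>4} {C\<^sub>4}]
        (ingleton A\<^sub>4 B\<^sub>4 C\<^sub>4 D\<^sub>4)) \<and>
     (essentially_conditional
        [cond_mut_info {A\<^sub>4} {B\<^sub>4} {C\<^sub>4}, cond_ent {C\<^sub>4} {A\<^sub>4, B\<^sub>4}]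
        (ingleton A\<^sub>4 B\<^sub>4 C\<^sub>4 D\<^sub>4)) \<and>
     (essentially_conditional
        [cond_mut_info {A\<^sub>5} {D\<^sub>5} {C\<^sub>5}, cond_mut_info {A\<^sub>5} {C\<^sub>5} {D\<^sub>5}]
        (ingleton A\<^sub>5 B\<^sub>5 C\<^sub>5 D\<^sub>5 + cond_mut_info {A\<^sub>5} {C\<^sub>5} {E\<^sub>5} + cond_mut_info {A\<^sub>5} {E\<^sub>5} {C\<^sub>5})) \<and>
     (essentially_conditional
        [cond_mut_info {B\<^sub>5} {C\<^sub>5} {D\<^sub>5}, cond_mut_info {C\<^sub>5} {D\<^sub>5} {B\<^sub>5}]
        (ingleton A\<^sub>5 B\<^sub>5 C\<^sub>5 D\<^sub>5 + cond_mut_info {B\<^sub>5} {C\<^sub>5} {E\<^sub>5} + cond_mut_info {C\<^sub>5} {E\<^sub>5} {B\<^sub>5})) \<and>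
     (essentially_conditional
        [cond_mut_info {B\<^sub>5} {C\<^sub>5} {D\<^sub>5}, cond_mut_info {C\<^sub>5} {D\<^sub>5} {B\<^sub>5}]
        (ingleton A\<^sub>5 B\<^sub>5 C\<^sub>5 D\<^sub>5 + cond_mut_info {C\<^sub>5} {D\<^sub>5} {E\<^sub>5} + cond_mut_info {C\<^sub>5} {E\<^sub>5} {D\<^sub>5})) \<and>
     (essentially_conditional
        [cond_mut_info {A\<^sub>4} {D\<^sub>4} {C\<^sub>4}, cond_mut_info {A\<^sub>4} {C\<^sub>4} {D\<^sub>4}]
        (ingleton A\<^sub>4 B\<^sub>4 C\<^sub>4 D\<^sub>4)) \<and>
     (essentially_conditional
        [cond_mut_info {B\<^sub>4} {C\<^sub>4} {D\<^sub>4}, cond_mut_info {C\<^sub>4} {D\<^sub>4} {B\<^sub>4}]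
        (ingleton A\<^sub>4 B\<^sub>4 C\<^sub>4 D\<^sub>4))"
proof (intro conjI)
  show "essentially_conditional
        [cond_mut_info {A\<^sub>4} {B\<^sub>4} {C\<^sub>4}, mut_info {A\<^sub>4} {B\<^sub>4}]
        (ingleton A\<^sub>4 B\<^sub>4 C\<^sub>4 D\<^sub>4)"
    by (rule essentially_conditionalI[OF eventually_is_dist_I1 eventually_neg_I1])
  show "essentially_conditional
        [cond_mut_info {A\<^sub>4} {B\<^sub>4} {C\<^sub>4}, cond_mut_info {B\<^sub>4} {D\<^sub>4} {C\<^sub>4}]
        (ingleton A\<^sub>4 B\<^sub>4 C\<^sub>4 D\<^sub>4)"
    by (rule essentially_conditionalI[OF eventually_is_dist_I2 eventually_neg_I2])
  show "essentially_conditional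
        [cond_mut_info {A\<^sub>4} {B\<^sub>4} {C\<^sub>4}, cond_ent {C\<^sub>4} {A\<^sub>4, B\<^sub>4}]
        (ingleton A\<^sub>4 B\<^sub>4 C\<^sub>4 D\<^sub>4)"
    by (rule essentially_conditionalI[OF eventually_is_dist_I3 eventually_neg_I3])
  show "essentially_conditional
        [cond_mut_info {A\<^sub>5} {D\<^sub>5} {C\<^sub>5}, cond_mut_info {A\<^sub>5} {C\<^sub>5} {D\<^sub>5}]
        (ingleton A\<^sub>5 B\<^sub>5 C\<^sub>5 D\<^sub>5 + cond_mut_info {A\<^sub>5} {C\<^sub>5} {E\<^sub>5} + cond_mut_info {A\<^sub>5} {E\<^sub>5} {C\<^sub>5})"
    \<comment> \<open>With E = C both extra terms become I(A:C|C).\<close>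
    by (rule essentially_conditionalI[OF eventually_is_dist_I4, where X = "\<lambda>i. vars_I4 (copy_var C\<^sub>4 i)"])
      (use eventually_neg_I4 in \<open>simp add: nat_info_value_add nat_info_value_copy_var
        nat_info_value_cond_mut_info_self\<close>)
  show "essentially_conditional
        [cond_mut_info {B\<^sub>5} {C\<^sub>5} {D\<^sub>5}, cond_mut_info {C\<^sub>5} {D\<^sub>5} {B\<^sub>5}]
        (ingleton A\<^sub>5 B\<^sub>5 C\<^sub>5 D\<^sub>5 + cond_mut_info {B\<^sub>5} {C\<^sub>5} {E\<^sub>5} + cond_mut_info {C\<^sub>5} {E\<^sub>5} {B\<^sub>5})"
    \<comment> \<open>With E = B they become I(B:C|B) and I(C:B|B).\<close>
    by (rule essentially_conditionalI[OF eventually_is_dist_I5, where X = "\<lambda>i. vars_I5 (copy_var B\<^sub>4 i)"])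
      (use eventually_neg_I5 in \<open>simp add: nat_info_value_add nat_info_value_copy_var
        nat_info_value_cond_mut_info_self\<close>)
  show "essentially_conditional
        [cond_mut_info {B\<^sub>5} {C\<^sub>5} {D\<^sub>5}, cond_mut_info {C\<^sub>5} {D\<^sub>5} {B\<^sub>5}]
        (ingleton A\<^sub>5 B\<^sub>5 C\<^sub>5 D\<^sub>5 + cond_mut_info {C\<^sub>5} {D\<^sub>5} {E\<^sub>5} + cond_mut_info {C\<^sub>5} {E\<^sub>5} {D\<^sub>5})"
    \<comment> \<open>With E = D both become I(C:D|D).\<close>
    by (rule essentially_conditionalI[OF eventually_is_dist_I5, where X = "\<lambda>i. vars_I5 (copy_var D\<^sub>4 i)"])
      (use eventually_neg_I5 in \<open>simp add: nat_info_value_add nat_info_value_copy_var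
        nat_info_value_cond_mut_info_self\<close>)
  show "essentially_conditional
        [cond_mut_info {A\<^sub>4} {D\<^sub>4} {C\<^sub>4}, cond_mut_info {A\<^sub>4} {C\<^sub>4} {D\<^sub>4}]
        (ingleton A\<^sub>4 B\<^sub>4 C\<^sub>4 D\<^sub>4)"
    by (rule essentially_conditionalI[OF eventually_is_dist_I4 eventually_neg_I4])
  show "essentially_conditional
        [cond_mut_info {B\<^sub>4} {C\<^sub>4} {D\<^sub>4}, cond_mut_info {C\<^sub>4} {D\<^sub>4} {B\<^sub>4}]
        (ingleton A\<^sub>4 B\<^sub>4 C\<^sub>4 D\<^sub>4)"
    by (rule essentially_conditionalI[OF eventually_is_dist_I5 eventually_neg_I5])
qed

end
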